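(* Let $n\ge1$, $r\ge2$ and $0\le a\le n$ be integers with $nr\equiv3\pmod 4$. There is no Hadamard matrix of order $nr+1$ with one circulant core whose core is generated by a sequence $A\in\mathbb{Z}_2^{rn}$ with $A\in\mathcal{G}_n(a)\times\cdots\times\mathcal{G}_n(a)\subset\mathcal{G}_{nr}(ar)$ ($r$ factors), i.e. $A=(Y_1,\dots,Y_r)$ with all $Y_i\in\mathcal{G}_n(a)$.
   Context: $\mathbb{Z}_2=\{+,-\}=\{1,-1\}$, and $\mathbb{Z}_2^m$ is the set of $\pm1$ sequences of length $m$. $\omega(X)$ is the number of entries of $X\in\mathbb{Z}_2^m$ equal to $+$, and $\mathcal{G}_m(k)=\{X\in\mathbb{Z}_2^m:\omega(X)=k\}$. Tuples of sequences denote concatenation. A Hadamard matrix of order $N$ is an $N\times N$ matrix $H$ with entries $\pm1$ and $HH^t=NI_N$. A Hadamard matrix with one circulant core $A\in\mathbb{Z}_2^{p}$ is a Hadamard matrix of order $p+1$ of the form $$H=\begin{pmatrix}1&e\\ e^t&A_C\end{pmatrix},$$ where $e=(1,\dots,1)$ has length $p$ and $A_C$ is the $p\times p$ circulant matrix whose rows are the cyclic shifts of $A$. *)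

theory Defs
  imports "Jordan_Normal_Form.Matrix"
begin

definition pm_seqs :: "nat \<Rightarrow> int list set" where
  "pm_seqs m = {X. length X = m \<and> set X \<subseteq> {1, -1}}"

definition omega :: "int list \<Rightarrow> nat" where
  "omega X = count_list X 1"

definition G_set :: "nat \<Rightarrow> nat \<Rightarrow> int list set" where
  "G_set m k = {X \<in> pm_seqs m. omega X = k}"

text \<open>The \<open>r\<close>-fold product \<open>G_set n a \<times> \<dots> \<times> G_set n a\<close>, a tuple
  \<open>(Y\<^sub>1, \<dots>, Y\<^sub>r)\<close> being identified with the concatenation of its entries.\<close>

definition G_prod :: "nat \<Rightarrow> nat \<Rightarrow> nat \<Rightarrow> int list set" where
  "G_prod r n a = {concat Ys | Ys. length Ys = r \<and> set Ys \<subseteq> G_set n a}"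

definition hadamard_mat :: "nat \<Rightarrow> int mat \<Rightarrow> bool" where
  "hadamard_mat N H \<longleftrightarrow> H \<in> carrier_mat N N \<and> elements_mat H \<subseteq> {1, -1} \<and>
     H * H\<^sup>T = of_nat N \<cdot>\<^sub>m 1\<^sub>m N"

text \<open>Row \<open>i\<close> is \<open>A\<close> cyclically shifted \<open>i\<close> places to the right. The summand
  \<open>length A\<close> keeps the subtraction on \<open>nat\<close> from truncating.\<close>

definition circulant_mat :: "int list \<Rightarrow> int mat" where
  "circulant_mat A = mat (length A) (length A)
     (\<lambda>(i, j). A ! ((j + length A - i) mod length A))"

definition bordered_mat :: "nat \<Rightarrow> int mat \<Rightarrow> int mat" where
  "bordered_mat p C = four_block_mat
     (mat 1 1 (\<lambda>_. 1)) (mat 1 p (\<lambda>_. 1))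
     (mat p 1 (\<lambda>_. 1)) C"

definition hadamard_one_circulant_core :: "nat \<Rightarrow> int list \<Rightarrow> int mat \<Rightarrow> bool" where
  "hadamard_one_circulant_core p A H \<longleftrightarrow> A \<in> pm_seqs p \<and>
     hadamard_mat (p + 1) H \<and> H = bordered_mat p (circulant_mat A)"

lemma G_prod_subset: "G_prod r n a \<subseteq> G_set (n * r) (a * r)"
proof
  fix A assume "A \<in> G_prod r n a"
  then obtain Ys where Ys: "A = concat Ys" "length Ys = r" "set Ys \<subseteq> G_set n a"
    by (auto simp: G_prod_def)
  have "concat Ys \<in> G_set (n * length Ys) (a * length Ys)"
    using Ys(3) by (induction Ys) (auto simp: G_set_def pm_seqs_def omega_def)
  then show "A \<in> G_set (n * r) (a * r)" using Ys by simp
qed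

end

theory Submission
  imports Defs
begin

text \<open>Orthogonality of the first two rows of a Hadamard matrix with one circulant core
  \<open>A\<close> forces the entries of \<open>A\<close> to sum to \<open>-1\<close>. If \<open>A\<close> consists of \<open>r\<close> blocks in
  \<open>G_set n a\<close>, the sum is \<open>r * (2 * a - n)\<close>, so \<open>r\<close> divides \<open>1\<close>.\<close>

lemma sum_list_pm:
  assumes "set X \<subseteq> {1, -1}"
  shows "sum_list X = 2 * int (omega X) - int (length X)"
  using assms by (induction X) (auto simp: omega_def)

lemma sum_list_circulant_core:
  assumes "hadamard_one_circulant_core p A H" and "p \<ge> 1"
  shows "sum_list A = -1"
proof -
  have len: "length A = p"
    and HH: "H * H\<^sup>T = of_nat (p + 1) \<cdot>\<^sub>m 1\<^sub>m (p + 1)"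
    and H: "H \<in> carrier_mat (p + 1) (p + 1)" "H = bordered_mat p (circulant_mat A)"
    using assms(1) by (auto simp: hadamard_one_circulant_core_def pm_seqs_def hadamard_mat_def)
  \<comment> \<open>Row 0 of \<open>H\<close> is all ones, so the product is the entry of row 1: the
    border 1 in column 0, then row 0 of the circulant, which is \<open>A\<close> unshifted, moved
    one column to the right.\<close>
  have entry: "H $$ (0, k) * H $$ (1, k) = (case k of 0 \<Rightarrow> 1 | Suc j \<Rightarrow> A ! j)"
    if "k < Suc p" for k
    using that assms(2) len
    by (auto simp: H(2) bordered_mat_def circulant_mat_def four_block_mat_def split: nat.split)
  have "0 = (H * H\<^sup>T) $$ (0, 1)"
    using assms(2) by (simp add: HH)
  also have "\<dots> = (\<Sum>k<Suc p. H $$ (0, k) * H $$ (1, k))"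
    using H(1) assms(2) by (simp add: scalar_prod_def atLeast0LessThan)
  also have "\<dots> = (\<Sum>k<Suc p. case k of 0 \<Rightarrow> 1 | Suc j \<Rightarrow> A ! j)"
    using entry by (intro sum.cong) auto
  also have "\<dots> = 1 + sum_list A"
    by (subst sum.lessThan_Suc_shift) (simp add: sum_list_sum_nth len atLeast0LessThan)
  finally show ?thesis by simp
qed

theorem theorem16:
  fixes n r a :: nat
  assumes "n \<ge> 1" and "r \<ge> 2" and "a \<le> n" and "(n * r) mod 4 = 3"
  shows "\<not> (\<exists>A H. A \<in> G_prod r n a \<and> hadamard_one_circulant_core (n * r) A H)"
proof
  assume "\<exists>A H. A \<in> G_prod r n a \<and> hadamard_one_circulant_core (n * r) A H"
  then obtain A H where A: "A \<in> G_prod r n a"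
    and H: "hadamard_one_circulant_core (n * r) A H" by blast
  \<comment> \<open>The blocks enter through the total count \<open>a * r\<close> of entries 1, a
    multiple of \<open>r\<close> just like the length.\<close>
  have "A \<in> G_set (n * r) (a * r)"
    using A G_prod_subset by blast
  then have "sum_list A = 2 * int (a * r) - int (n * r)"
    using sum_list_pm[of A] by (simp add: G_set_def pm_seqs_def)
  moreover have "sum_list A = -1"
    using sum_list_circulant_core[OF H] assms(1,2) by simp
  \<comment> \<open>Equating the two values of the sum and negating exposes \<open>r\<close> as a
    factor of 1.\<close>
  ultimately have "int r * (int n - 2 * int a) = 1"
    by (simp add: algebra_simps)
  then have "int r dvd 1"
    by (metis dvd_triv_left)
  with assms(2) show False by simp
qed

end
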